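(* Let $n\ge2$ be a power of $2$, let $x_0\in\mathbf{R}^n$ satisfy $\sum_{i=1}^n x_{0,i}=0$, and let $(x_k)_{k\ge0}$ be the repeated averaging chain on $\mathbf{R}^n$ started from $x_0$. Then with probability $1$, $x_k=0$ for all large enough $k$.
   Context: Repeated averaging chain on $\mathbf{R}^n$: given $x_k=(x_{k,1},\ldots,x_{k,n})$, pick a pair of distinct indices $I,J\in\{1,\ldots,n\}$ uniformly at random (independently of the past), replace both $x_{k,I}$ and $x_{k,J}$ by $(x_{k,I}+x_{k,J})/2$, and keep all other coordinates the same; the result is $x_{k+1}$. Here $0$ denotes the zero vector of $\mathbf{R}^n$. *)

theory Defs
  imports "HOL-Probability.Probability"
begin

definition average_pair :: "'n \<times> 'n \<Rightarrow> real ^ 'n \<Rightarrow> real ^ 'n::finite" where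
  "average_pair p x =
     (\<chi> i. if i = fst p \<or> i = snd p then (x $ fst p + x $ snd p) / 2 else x $ i)"

text \<open>
  The coordinates are indexed by a finite type \<open>'n\<close>, so that \<open>n = CARD('n)\<close>.
  \<open>IJ k = (I, J)\<close> is the pair picked to pass from \<open>x k\<close> to \<open>x (Suc k)\<close>. Picking each pair
  independently of the past amounts to mutual independence of the whole family \<open>IJ\<close>, since the
  starting point \<open>x0\<close> is deterministic. Pairs are ordered; as \<^const>\<open>average_pair\<close> is symmetric in
  the two indices, uniform unordered pairs give the same chain.
\<close>

locale repeated_averaging_chain = prob_space M
  for M :: "'a measure" +
  fixes x0 :: "real ^ 'n::finite"
    and IJ :: "nat \<Rightarrow> 'a \<Rightarrow> 'n \<times> 'n"
    and x :: "nat \<Rightarrow> 'a \<Rightarrow> real ^ 'n"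
  assumes indep_IJ: "indep_vars (\<lambda>_. count_space UNIV) IJ UNIV"
    and uniform_IJ: "\<And>k. distr M (count_space UNIV) (IJ k) = measure_pmf (pmf_of_set {(i, j). i \<noteq> j})"
    and start: "\<And>\<omega>. \<omega> \<in> space M \<Longrightarrow> x 0 \<omega> = x0"
    and step: "\<And>k \<omega>. \<omega> \<in> space M \<Longrightarrow> x (Suc k) \<omega> = average_pair (IJ k \<omega>) (x k \<omega>)"

end

theory Submission
  imports Defs
begin

text \<open>
  When the dimension is a power of two, a fixed finite word of pairs replaces every vector by its
  mean: average out the two halves of the index set recursively, then match them up pairwise.
  Averaging preserves the coordinate sum, so this word sends a sum-zero vector to 0, which is
  absorbing. Since the pairs are independent and uniform, the word almost surely occurs.
\<close>

lemma average_pair_zero [simp]: "average_pair p 0 = 0"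
  by (simp add: average_pair_def vec_eq_iff)

text \<open>The degenerate case \<open>fst p = snd p\<close> is covered too, so the sum is conserved
  on every path in \<open>space M\<close>, including the null set of paths on which a diagonal pair
  is drawn.\<close>

lemma sum_average_pair: "(\<Sum>i\<in>UNIV. average_pair p x $ i) = (\<Sum>i\<in>UNIV. x $ i)"
proof (cases "fst p = snd p")
  case True
  then have "average_pair p x = x"
    by (simp add: average_pair_def vec_eq_iff)
  then show ?thesis by simp
next
  case False
  have split: "(\<Sum>i\<in>UNIV. f i) = f (fst p) + f (snd p) + (\<Sum>i\<in>UNIV - {fst p, snd p}. f i)" for f :: "'a \<Rightarrow> real"
    using False sum.subset_diff[of "{fst p, snd p}" UNIV f] by simp
  have "(\<Sum>i\<in>UNIV - {fst p, snd p}. average_pair p x $ i) = (\<Sum>i\<in>UNIV - {fst p, snd p}. x $ i)"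
    by (intro sum.cong) (auto simp: average_pair_def)
  then show ?thesis
    unfolding split[of "\<lambda>i. average_pair p x $ i"] split[of "\<lambda>i. x $ i"]
    by (simp add: average_pair_def)
qed

text \<open>Disjointness of \<open>set as\<close> from its image and injectivity of \<open>f\<close>
  make the pairs pairwise disjoint. Each averaging therefore meets entries that earlier pairs left
  alone, still \<open>a\<close> and \<open>b\<close>.\<close>

lemma fold_average_pair_matching:
  fixes f :: "'n::finite \<Rightarrow> 'n"
  assumes "distinct as" "inj_on f (set as)" "set as \<inter> f ` set as = {}"
    and "\<And>i. i \<in> set as \<Longrightarrow> y $ i = a" "\<And>i. i \<in> set as \<Longrightarrow> y $ f i = b"
  shows "fold average_pair (map (\<lambda>i. (i, f i)) as) y =
    (\<chi> i. if i \<in> set as \<union> f ` set as then (a + b) / 2 else y $ i)"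
  using assms
proof (induction as arbitrary: y)
  case Nil
  then show ?case by (simp add: vec_eq_iff)
next
  case (Cons c as)
  define z where "z = average_pair (c, f c) y"
  have z: "z $ i = (if i = c \<or> i = f c then (a + b) / 2 else y $ i)" for i
    using Cons.prems by (auto simp: z_def average_pair_def)
  have "fold average_pair (map (\<lambda>i. (i, f i)) as) z =
    (\<chi> i. if i \<in> set as \<union> f ` set as then (a + b) / 2 else z $ i)"
  proof (rule Cons.IH)
    show "z $ i = a" if "i \<in> set as" for i
      using that Cons.prems by (auto simp: z)
    show "z $ f i = b" if "i \<in> set as" for i
    proof -
      have "f i \<noteq> c" "f i \<noteq> f c"
        using that Cons.prems(1-3) by (auto simp: image_iff)
      then show ?thesis
        using that Cons.prems(5) by (simp add: z)
    qed
  qed (use Cons.prems in auto)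
  then show ?case
    by (auto simp: z_def[symmetric] vec_eq_iff z)
qed

text \<open>Induction on \<open>m\<close> forces the claim for arbitrary \<open>S\<close> with
  entries outside \<open>S\<close> fixed: the word for one half must not disturb the other.
  Excluding diagonal pairs ensures that the chain picks each letter with positive
  probability.\<close>

lemma exists_averaging_word:
  fixes S :: "'n::finite set"
  assumes "card S = 2 ^ m"
  shows "\<exists>w. (\<forall>p\<in>set w. fst p \<noteq> snd p) \<and>
    (\<forall>x. fold average_pair w x = (\<chi> i. if i \<in> S then (\<Sum>j\<in>S. x $ j) / 2 ^ m else x $ i))"
  using assms
proof (induction m arbitrary: S)
  case 0
  then obtain s where "S = {s}" by (auto simp: card_1_singleton_iff)
  then show ?case by (intro exI[of _ "[]"]) (simp add: vec_eq_iff)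
next
  case (Suc m)
  obtain A where A: "A \<subseteq> S" "card A = 2 ^ m"
    using obtain_subset_with_card_n[of "2 ^ m" S] Suc.prems by auto
  define B where "B = S - A"
  have B: "card B = 2 ^ m" "A \<inter> B = {}" "S = A \<union> B"
    using A Suc.prems by (auto simp: B_def card_Diff_subset)
  obtain u where u: "\<forall>p\<in>set u. fst p \<noteq> snd p"
    "\<And>x. fold average_pair u x = (\<chi> i. if i \<in> A then (\<Sum>j\<in>A. x $ j) / 2 ^ m else x $ i)"
    using Suc.IH[OF A(2)] by blast
  obtain v where v: "\<forall>p\<in>set v. fst p \<noteq> snd p"
    "\<And>x. fold average_pair v x = (\<chi> i. if i \<in> B then (\<Sum>j\<in>B. x $ j) / 2 ^ m else x $ i)"
    using Suc.IH[OF B(1)] by blast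
  obtain f where f: "bij_betw f A B"
    using A B finite_same_card_bij[of A B] by auto
  obtain as where as: "set as = A" "distinct as"
    using finite_distinct_list[of A] by auto
  have fA: "f ` A = B" "inj_on f A"
    using f by (auto simp: bij_betw_def)
  \<comment> \<open>\<open>fold\<close> reads the list from the left: flatten \<open>A\<close>,
    flatten \<open>B\<close>, then average each entry of \<open>A\<close> with its partner in
    \<open>B\<close>. As the halves have equal size, the average of their means is the mean over
    \<open>S\<close>.\<close>
  define w where "w = u @ v @ map (\<lambda>i. (i, f i)) as"
  have "fst p \<noteq> snd p" if "p \<in> set w" for p
    using that u(1) v(1) as fA B(2) by (auto simp: w_def)
  moreover have "fold average_pair w x =
      (\<chi> i. if i \<in> S then (\<Sum>j\<in>S. x $ j) / 2 ^ Suc m else x $ i)" for x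
  proof -
    define y where "y = fold average_pair v (fold average_pair u x)"
    \<comment> \<open>The word \<open>v\<close> runs after \<open>u\<close>, but \<open>u\<close>
      changes entries in \<open>A\<close> only, so \<open>v\<close> still sees the original sum over
      \<open>B\<close>.\<close>
    have "(\<Sum>j\<in>B. (if j \<in> A then (\<Sum>j\<in>A. x $ j) / 2 ^ m else x $ j)) = (\<Sum>j\<in>B. x $ j)"
      using B(2) by (intro sum.cong) auto
    then have y: "y $ i = (if i \<in> A then (\<Sum>j\<in>A. x $ j) / 2 ^ m
        else if i \<in> B then (\<Sum>j\<in>B. x $ j) / 2 ^ m else x $ i)" for i
      using B(2) by (auto simp: y_def u(2) v(2))
    have "fold average_pair w x = (\<chi> i. if i \<in> A \<union> B
        then ((\<Sum>j\<in>A. x $ j) / 2 ^ m + (\<Sum>j\<in>B. x $ j) / 2 ^ m) / 2 else y $ i)"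
    proof -
      have "f i \<in> B" "f i \<notin> A" if "i \<in> A" for i
        using that fA(1) B(2) by auto
      then show ?thesis
        unfolding w_def
        using fold_average_pair_matching[of as f y "(\<Sum>j\<in>A. x $ j) / 2 ^ m" "(\<Sum>j\<in>B. x $ j) / 2 ^ m"]
          as fA B(2)
        by (simp add: y y_def[symmetric])
    qed
    moreover have "(\<Sum>j\<in>S. x $ j) = (\<Sum>j\<in>A. x $ j) + (\<Sum>j\<in>B. x $ j)"
      unfolding B(3) using B(2) by (intro sum.union_disjoint) auto
    ultimately show ?thesis
      using B(3) by (auto simp: vec_eq_iff y field_simps)
  qed
  ultimately show ?case by blast
qed

text \<open>Cut time into consecutive blocks of the length \<open>L\<close> of \<open>w\<close>.
  Distinct blocks are independent and each spells \<open>w\<close> with probability at least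
  \<open>c ^ L\<close>, so the first \<open>n\<close> blocks all fail with probability at most
  \<open>(1 - c ^ L) ^ n\<close>, which tends to 0.\<close>

lemma (in prob_space) AE_word_occurs:
  fixes X :: "nat \<Rightarrow> 'a \<Rightarrow> 'b"
  assumes indep: "indep_vars (\<lambda>_. count_space UNIV) X UNIV"
    and "c > 0" and c: "\<And>k a. a \<in> set w \<Longrightarrow> c \<le> prob (X k -` {a} \<inter> space M)"
  shows "AE \<omega> in M. \<exists>k. \<forall>j<length w. X (k + j) \<omega> = w ! j"
proof (cases "w = []")
  case True
  then show ?thesis by simp
next
  case False
  define L where "L = length w"
  \<comment> \<open>Nonempty blocks are needed for the division by \<open>L\<close> and for the
    product rule of independence, hence the separate case of the empty word.\<close>
  have "L > 0" using False by (simp add: L_def)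
  define K where "K m = {m * L..<m * L + L}" for m
  define occ where "occ m g \<longleftrightarrow> (\<forall>i\<in>K m. g i = w ! (i - m * L))" for m and g :: "nat \<Rightarrow> 'b"
  define N where "N m = {\<omega>\<in>space M. \<not> occ m (\<lambda>i. X i \<omega>)}" for m
  have meas: "X i \<in> measurable M (count_space UNIV)" for i
    using indep by (simp add: indep_vars_def2)
  have [measurable]: "X i -` {a} \<inter> space M \<in> events" for i a
    using measurable_sets[OF meas] by simp
  have "disjoint_family_on K UNIV"
  proof -
    have "m = n" if "i \<in> K m" "i \<in> K n" for i m n
    proof -
      have "i div L = m" "i div L = n"
        using that \<open>L > 0\<close> by (auto simp: K_def mult.commute intro!: div_nat_eqI)
      then show ?thesis by simp
    qed
    then show ?thesis by (auto simp: disjoint_family_on_def)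
  qed
  then have blocks: "indep_vars (\<lambda>m. PiM (K m) (\<lambda>_. count_space UNIV))
      (\<lambda>m \<omega>. restrict (\<lambda>i. X i \<omega>) (K m)) UNIV"
    by (intro indep_vars_restrict[OF indep]) auto
  have "occ m \<in> measurable (PiM (K m) (\<lambda>_. count_space UNIV)) (count_space UNIV)" for m
  proof -
    \<comment> \<open>For arbitrary \<open>'b\<close> the product sigma-algebra may miss some sets,
      but this event is a finite box of singletons.\<close>
    have "{g \<in> space (PiM (K m) (\<lambda>_. count_space UNIV)). occ m g} =
        PiE (K m) (\<lambda>i. {w ! (i - m * L)})"
      by (auto simp: occ_def space_PiM PiE_iff extensional_def)
    also have "\<dots> \<in> sets (PiM (K m) (\<lambda>_. count_space UNIV))"
      by (intro sets_PiM_I_finite) (auto simp: K_def)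
    finally show ?thesis by (simp add: pred_def)
  qed
  from indep_vars_compose2[OF blocks this]
  have indep_occ: "indep_vars (\<lambda>_. count_space UNIV) (\<lambda>m \<omega>. occ m (\<lambda>i. X i \<omega>)) UNIV"
    by (simp add: occ_def)
  have N_eq: "N m = (\<lambda>\<omega>. occ m (\<lambda>i. X i \<omega>)) -` {False} \<inter> space M" for m
    by (auto simp: N_def)
  have [measurable]: "N m \<in> events" for m
    using indep_occ unfolding N_eq by (auto simp: indep_vars_def2 intro!: measurable_sets)
  have N_le: "prob (N m) \<le> 1 - c ^ L" for m
  proof -
    have "c ^ L = (\<Prod>i\<in>K m. c)" by (simp add: K_def)
    also have "\<dots> \<le> (\<Prod>i\<in>K m. prob (X i -` {w ! (i - m * L)} \<inter> space M))"
      using \<open>c > 0\<close> by (intro prod_mono conjI c) (auto simp: K_def L_def)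
    also have "\<dots> = prob (\<Inter>i\<in>K m. X i -` {w ! (i - m * L)} \<inter> space M)"
      using \<open>L > 0\<close>
      by (intro indep_varsD_finite[OF indep_vars_subset[OF indep], symmetric]) (auto simp: K_def)
    also have "(\<Inter>i\<in>K m. X i -` {w ! (i - m * L)} \<inter> space M) = space M - N m"
      using \<open>L > 0\<close> by (auto simp: N_def occ_def K_def)
    also have "prob \<dots> = 1 - prob (N m)"
      by (intro prob_compl) simp
    finally show ?thesis by simp
  qed
  \<comment> \<open>That \<open>c ^ L\<close> is at most 1 is read off from \<open>N_le\<close>,
    since a probability is nonnegative.\<close>
  have cL: "0 < c ^ L" "0 \<le> 1 - c ^ L"
    using \<open>c > 0\<close> order_trans[OF measure_nonneg N_le[of 0]] by simp_all
  \<comment> \<open>\<open>n > 0\<close> keeps \<open>{..<n}\<close> nonempty for the product rule;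
    the limit argument below accordingly starts at 1.\<close>
  have le: "prob (\<Inter>m. N m) \<le> (1 - c ^ L) ^ n" if "n > 0" for n
  proof -
    have "prob (\<Inter>m. N m) \<le> prob (\<Inter>m\<in>{..<n}. N m)"
      using that by (intro finite_measure_mono) (auto intro!: sets.finite_INT)
    also have "\<dots> = (\<Prod>m\<in>{..<n}. prob (N m))"
      unfolding N_eq using that by (intro indep_varsD_finite[OF indep_vars_subset[OF indep_occ]]) auto
    also have "\<dots> \<le> (\<Prod>m\<in>{..<n}. 1 - c ^ L)"
      by (intro prod_mono conjI N_le measure_nonneg)
    finally show ?thesis by simp
  qed
  have "(\<lambda>n. (1 - c ^ L) ^ n) \<longlonglongrightarrow> 0"
    using cL by (intro LIMSEQ_realpow_zero) auto
  then have "prob (\<Inter>m. N m) \<le> 0"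
    by (rule LIMSEQ_le_const) (use le in \<open>auto intro!: exI[of _ 1]\<close>)
  then have "emeasure M (\<Inter>m. N m) = 0"
    by (simp add: emeasure_eq_measure measure_le_0_iff)
  then have "AE \<omega> in M. \<omega> \<notin> (\<Inter>m. N m)"
    by (intro AE_not_in) (auto simp: null_sets_def)
  then show ?thesis
  proof (rule AE_mp, intro AE_I2 impI)
    fix \<omega> assume "\<omega> \<in> space M" "\<omega> \<notin> (\<Inter>m. N m)"
    then obtain m where "occ m (\<lambda>i. X i \<omega>)" by (auto simp: N_def)
    then have "\<forall>j<length w. X (m * L + j) \<omega> = w ! j"
      by (auto simp: occ_def K_def L_def)
    then show "\<exists>k. \<forall>j<length w. X (k + j) \<omega> = w ! j" ..
  qed
qed

context repeated_averaging_chain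
begin

lemma prob_IJ:
  assumes "fst p \<noteq> snd p"
  shows "prob (IJ k -` {p} \<inter> space M) = 1 / card {(i, j :: 'n). i \<noteq> j}"
proof -
  have "IJ k \<in> measurable M (count_space UNIV)"
    using indep_IJ by (simp add: indep_vars_def2)
  then have "prob (IJ k -` {p} \<inter> space M) = measure (distr M (count_space UNIV) (IJ k)) {p}"
    by (simp add: measure_distr)
  also have "\<dots> = pmf (pmf_of_set {(i, j). i \<noteq> j}) p"
    by (simp add: uniform_IJ measure_pmf_single)
  also have "\<dots> = 1 / card {(i, j :: 'n). i \<noteq> j}"
    using assms by (subst pmf_of_set) (auto simp: indicator_def split: prod.splits)
  finally show ?thesis .
qed

lemma sum_x: "\<omega> \<in> space M \<Longrightarrow> (\<Sum>i\<in>UNIV. x k \<omega> $ i) = (\<Sum>i\<in>UNIV. x0 $ i)"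
  by (induction k) (simp_all add: start step sum_average_pair)

text \<open>Presents consecutive steps of the chain as a word, so that the deterministic statement
  about words applies from any time \<open>k\<close>.\<close>

lemma x_add:
  assumes "\<omega> \<in> space M"
  shows "x (k + n) \<omega> = fold average_pair (map (\<lambda>j. IJ (k + j) \<omega>) [0..<n]) (x k \<omega>)"
  by (induction n) (simp_all add: step assms)

lemma x_zero_absorbing:
  assumes "\<omega> \<in> space M" "x k \<omega> = 0" "k \<le> l"
  shows "x l \<omega> = 0"
  using assms(3) by (induction l rule: dec_induct) (simp_all add: step assms)

end

theorem proposition2p14:
  fixes M :: "'a measure"
    and x0 :: "real ^ 'n::finite"
    and IJ :: "nat \<Rightarrow> 'a \<Rightarrow> 'n \<times> 'n"
    and x :: "nat \<Rightarrow> 'a \<Rightarrow> real ^ 'n"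
  assumes "CARD('n) \<ge> 2"
    and "\<exists>m. CARD('n) = 2 ^ m"
    and "(\<Sum>i\<in>UNIV. x0 $ i) = 0"
    and "repeated_averaging_chain M x0 IJ x"
  shows "AE \<omega> in M. \<forall>\<^sub>F k in sequentially. x k \<omega> = 0"
proof -
  interpret repeated_averaging_chain M x0 IJ x by fact
  obtain m where "CARD('n) = 2 ^ m" using assms(2) by blast
  from exists_averaging_word[OF this] obtain w :: "('n \<times> 'n) list"
    where w: "\<And>p. p \<in> set w \<Longrightarrow> fst p \<noteq> snd p"
      "\<And>y. fold average_pair w y = (\<chi> i. (\<Sum>j\<in>UNIV. y $ j) / 2 ^ m)"
    by auto
  \<comment> \<open>Two distinct indices exist, so the common probability of the admissible pairs is
    positive and can serve as \<open>c\<close>.\<close>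
  have "\<exists>i j :: 'n. i \<noteq> j"
    using assms(1) card_le_Suc0_iff_eq[of "UNIV :: 'n set"] by force
  then have "0 < 1 / card {(i, j :: 'n). i \<noteq> j}"
    by (auto simp: card_gt_0_iff)
  then have "AE \<omega> in M. \<exists>k. \<forall>j<length w. IJ (k + j) \<omega> = w ! j"
    by (rule AE_word_occurs[OF indep_IJ]) (simp add: prob_IJ w(1))
  then show ?thesis
  proof (rule AE_mp, intro AE_I2 impI)
    fix \<omega> assume \<omega>: "\<omega> \<in> space M" and "\<exists>k. \<forall>j<length w. IJ (k + j) \<omega> = w ! j"
    then obtain k where "\<forall>j<length w. IJ (k + j) \<omega> = w ! j" by blast
    then have "map (\<lambda>j. IJ (k + j) \<omega>) [0..<length w] = w"
      by (intro nth_equalityI) auto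
    \<comment> \<open>The word starts at a random time \<open>k\<close> from an unknown state, but
      that state still has sum zero by \<open>sum_x\<close>, so its mean is 0.\<close>
    then have "x (k + length w) \<omega> = 0"
      using \<omega> assms(3) by (simp add: x_add w(2) sum_x vec_eq_iff)
    then show "\<forall>\<^sub>F k in sequentially. x k \<omega> = 0"
      using x_zero_absorbing[OF \<omega>] by (auto simp: eventually_sequentially)
  qed
qed

end
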